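(* Let $K$ be a locally compact Hausdorff space and $X$ be a Banach space. Then the following are equivalent: (i) $C_0(K,X)$ has the BCP; (ii) $C_0(K)$ and $X$ both have the BCP; (iii) $K$ has a countable $\pi$-basis and $X$ has the BCP.
   Context: $C_0(K,X)$ is the Banach space of continuous functions from $K$ into $X$ vanishing at infinity, endowed with the supremum norm; $C_0(K)$ is the same space with $X$ replaced by the scalar field. A $\pi$-basis of a topological space $K$ is a collection $\mathcal U$ of nonempty open subsets of $K$ such that every nonempty open subset of $K$ contains some member of $\mathcal U$. A normed space has the ball-covering property (BCP) if its unit sphere (the set of vectors of norm one) can be covered by countably many closed, or equivalently open, balls, none of which contains the origin. *)

theory Defs
  imports "HOL-Analysis.Analysis"
begin

text \<open>The space of continuous functions vanishing at infinity, as a subset of the type of bounded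
  continuous functions, whose norm is the supremum norm. Boundedness is no restriction: see
  \<open>vanishing_bcontfun\<close> below.\<close>

definition C0 :: "('k::topological_space \<Rightarrow>\<^sub>C 'x::real_normed_vector) set" where
  "C0 = {f. \<forall>e>0. \<exists>C. compact C \<and> (\<forall>t. t \<notin> C \<longrightarrow> norm (apply_bcontfun f t) < e)}"

lemma vanishing_bcontfun:
  fixes f :: "'k::topological_space \<Rightarrow> 'x::real_normed_vector"
  assumes cont: "continuous_on UNIV f"
    and van: "\<forall>e>0. \<exists>C. compact C \<and> (\<forall>t. t \<notin> C \<longrightarrow> norm (f t) < e)"
  shows "f \<in> bcontfun"
proof -
  from van obtain C where C: "compact C" "\<And>t. t \<notin> C \<Longrightarrow> norm (f t) < 1"
    using zero_less_one by metis
  have "compact (f ` C)"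
    using C(1) cont by (meson compact_continuous_image continuous_on_subset subset_UNIV)
  then obtain b where b: "\<forall>y\<in>f ` C. norm y \<le> b"
    using compact_imp_bounded bounded_iff by metis
  have "norm (f t) \<le> max b 1" for t
    using b C(2)[of t] by (cases "t \<in> C") (auto simp: max_def)
  then have "bounded (range f)"
    unfolding bounded_iff by auto
  with cont show ?thesis by (simp add: bcontfun_def)
qed

lemma subspace_C0: "subspace (C0 :: ('k::topological_space \<Rightarrow>\<^sub>C 'x::real_normed_vector) set)"
  unfolding subspace_def
proof (intro conjI ballI allI)
  show "0 \<in> (C0 :: ('k \<Rightarrow>\<^sub>C 'x) set)"
    unfolding C0_def by (auto intro: exI[of _ "{}"])
next
  fix f g :: "'k \<Rightarrow>\<^sub>C 'x" assume fg: "f \<in> C0" "g \<in> C0"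
  show "f + g \<in> C0" unfolding C0_def
  proof (intro CollectI allI impI)
    fix e :: real assume "e > 0"
    then have e2: "e / 2 > 0" by simp
    from fg(1) e2 obtain C where C: "compact C" "\<And>t. t \<notin> C \<Longrightarrow> norm (apply_bcontfun f t) < e/2"
      unfolding C0_def by blast
    from fg(2) e2 obtain D where D: "compact D" "\<And>t. t \<notin> D \<Longrightarrow> norm (apply_bcontfun g t) < e/2"
      unfolding C0_def by blast
    have "norm (apply_bcontfun (f + g) t) < e" if "t \<notin> C \<union> D" for t
      using that C(2)[of t] D(2)[of t]
        norm_triangle_ineq[of "apply_bcontfun f t" "apply_bcontfun g t"] by auto
    then show "\<exists>C. compact C \<and> (\<forall>t. t \<notin> C \<longrightarrow> norm (apply_bcontfun (f + g) t) < e)"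
      using compact_Un[OF C(1) D(1)] by blast
  qed
next
  fix c :: real and f :: "'k \<Rightarrow>\<^sub>C 'x" assume f: "f \<in> C0"
  show "c *\<^sub>R f \<in> C0" unfolding C0_def
  proof (intro CollectI allI impI)
    fix e :: real assume e: "e > 0"
    then have "e / (\<bar>c\<bar> + 1) > 0" by simp
    with f obtain C where C: "compact C"
      "\<And>t. t \<notin> C \<Longrightarrow> norm (apply_bcontfun f t) < e / (\<bar>c\<bar> + 1)"
      unfolding C0_def by blast
    have "norm (apply_bcontfun (c *\<^sub>R f) t) < e" if "t \<notin> C" for t
    proof -
      have "norm (apply_bcontfun (c *\<^sub>R f) t) \<le> (\<bar>c\<bar> + 1) * norm (apply_bcontfun f t)"
        by (simp add: mult_right_mono)
      also have "\<dots> < e"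
        using C(2)[OF that] by (simp add: field_simps)
      finally show ?thesis .
    qed
    with C(1) show "\<exists>C. compact C \<and> (\<forall>t. t \<notin> C \<longrightarrow> norm (apply_bcontfun (c *\<^sub>R f) t) < e)"
      by blast
  qed
qed

definition pi_basis :: "'k::topological_space set set \<Rightarrow> bool" where
  "pi_basis \<U> \<longleftrightarrow> (\<forall>U\<in>\<U>. open U \<and> U \<noteq> {}) \<and>
    (\<forall>V. open V \<and> V \<noteq> {} \<longrightarrow> (\<exists>U\<in>\<U>. U \<subseteq> V))"

text \<open>The ball-covering property of a linear subspace \<open>S\<close>, regarded as a normed space in its own
  right: the centres of the balls must lie in \<open>S\<close>. The balls are given by their centres and
  radii. Only the norm is involved, so this serves real and complex spaces alike.\<close>

definition BCP :: "'a::real_normed_vector set \<Rightarrow> bool" where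
  "BCP S \<longleftrightarrow> (\<exists>B :: ('a \<times> real) set. countable B \<and>
    (\<forall>(c, r)\<in>B. c \<in> S \<and> r > 0 \<and> 0 \<notin> cball c r) \<and>
    {v \<in> S. norm v = 1} \<subseteq> (\<Union>(c, r)\<in>B. cball c r))"

text \<open>\<open>'x\<close> is a Banach space over \<open>'f\<close> with scalar multiplication \<open>scale\<close>. The sort of \<open>'f\<close>
  admits exactly the real and the complex numbers, up to isometric isomorphism: these are the
  only finite-dimensional commutative real division algebras with a multiplicative norm. The norm
  of a Banach space over \<open>'f\<close> also makes it a real Banach space by restriction of scalars, and
  that structure is the one provided by the class.\<close>

locale banach_space_over = vector_space scale
  for scale :: "'f::{real_normed_field, euclidean_space} \<Rightarrow> 'x::banach \<Rightarrow> 'x" +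
  assumes norm_scale: "norm (scale a x) = norm a * norm x"
    and scale_of_real: "scale (of_real r) x = r *\<^sub>R x"

lemma banach_space_over_real: "banach_space_over ((*\<^sub>R) :: real \<Rightarrow> 'x::banach \<Rightarrow> 'x)"
  by unfold_locales (auto simp: algebra_simps)

lemma banach_space_over_complex: "banach_space_over ((*) :: complex \<Rightarrow> complex \<Rightarrow> complex)"
  by unfold_locales (auto simp: algebra_simps norm_mult scaleR_conv_of_real)

end

theory Submission
  imports Defs
begin

text \<open>Write \<open>\<phi> x\<close> for the function \<open>t \<mapsto> \<phi>(t) x\<close>, where \<open>\<phi>\<close> is a bump function.
  If balls with centres \<open>f\<^sub>n\<close> and radii \<open>r\<^sub>n\<close> witness the BCP of \<open>C\<^sub>0(K,X)\<close>, the sets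
  \<open>{t. \<parallel>f\<^sub>n(t)\<parallel> > r\<^sub>n}\<close> form a \<open>\<pi>\<close>-basis: a ball containing \<open>\<phi> x\<close>, with \<open>\<phi>\<close> supported in \<open>V\<close>,
  has \<open>\<parallel>f\<^sub>n\<parallel> \<le> r\<^sub>n\<close> outside \<open>V\<close>. Evaluating at points \<open>t\<^sub>n\<close> of these sets and dividing by \<open>\<phi>(t\<^sub>n)\<close>,
  for one fixed \<open>\<phi>\<close>, gives a ball covering of the sphere of \<open>X\<close>.
  Conversely, dilating a ball of the covering of the sphere of \<open>X\<close> away from the origin makes its
  radius at least 1; then the bump functions of the \<open>\<pi>\<close>-basis times the dilated centres are centres
  of balls covering the sphere of \<open>C\<^sub>0(K,X)\<close>. Only the real normed structure of \<open>X\<close> matters, and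
  the scalar field, being separable, is the special case \<open>X = 'f\<close>.\<close>

section \<open>Countable ball coverings of unit spheres\<close>

lemma BCP_I:
  assumes "countable I" "\<And>i. i \<in> I \<Longrightarrow> c i \<in> S \<and> 0 < r i \<and> r i < norm (c i)"
    and "\<And>v. v \<in> S \<Longrightarrow> norm v = 1 \<Longrightarrow> \<exists>i\<in>I. norm (v - c i) \<le> r i"
  shows "BCP S"
  unfolding BCP_def
proof (intro exI[of _ "(\<lambda>i. (c i, r i)) ` I"] conjI)
  show "countable ((\<lambda>i. (c i, r i)) ` I)"
    using assms(1) by simp
  show "\<forall>(c, r)\<in>(\<lambda>i. (c i, r i)) ` I. c \<in> S \<and> r > 0 \<and> 0 \<notin> cball c r"
    using assms(2) by (force simp: dist_norm)
  show "{v \<in> S. norm v = 1} \<subseteq> (\<Union>(c, r)\<in>(\<lambda>i. (c i, r i)) ` I. cball c r)"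
    using assms(3) by (force simp: dist_norm norm_minus_commute)
qed

lemma BCP_E:
  assumes "BCP S"
  obtains B where "countable B" "\<And>c r. (c, r) \<in> B \<Longrightarrow> c \<in> S \<and> 0 < r \<and> r < norm c"
    "\<And>v. v \<in> S \<Longrightarrow> norm v = 1 \<Longrightarrow> \<exists>(c, r)\<in>B. norm (v - c) \<le> r"
proof -
  from assms obtain B where B: "countable B"
    "\<forall>(c, r)\<in>B. c \<in> S \<and> r > 0 \<and> 0 \<notin> cball c r"
    "{v \<in> S. norm v = 1} \<subseteq> (\<Union>(c, r)\<in>B. cball c r)"
    unfolding BCP_def by blast
  show ?thesis
  proof
    show "countable B" by fact
    show "c \<in> S \<and> 0 < r \<and> r < norm c" if "(c, r) \<in> B" for c r
      using B(2) that by (force simp: dist_norm)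
    show "\<exists>(c, r)\<in>B. norm (v - c) \<le> r" if "v \<in> S" "norm v = 1" for v
      using B(3) that by (force simp: dist_norm norm_minus_commute)
  qed
qed

text \<open>Separability suffices: balls of radius 1/2 about the points of a countable dense set
  cover the sphere, and those that meet it have centres of norm greater than 1/2 when the distance
  is below 1/2.\<close>

lemma BCP_euclidean_space: "BCP (UNIV :: 'a::euclidean_space set)"
proof -
  obtain D :: "'a set" where D: "countable D" "\<And>X. open X \<Longrightarrow> X \<noteq> {} \<Longrightarrow> \<exists>d\<in>D. d \<in> X"
    using countable_dense_setE by blast
  show ?thesis
  proof (rule BCP_I[where I = "{d \<in> D. 1/2 < norm d}" and c = id and r = "\<lambda>_. 1/2"])
    show "countable {d \<in> D. 1/2 < norm d}"
      using D(1) by (rule countable_subset[rotated]) auto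
    fix v :: 'a assume v: "norm v = 1"
    obtain d where d: "d \<in> D" "norm (v - d) < 1/2"
      using D(2)[of "ball v (1/2)"] by (auto simp: dist_norm)
    have "1/2 < norm d"
      using d(2) v norm_triangle_ineq2[of v d] by linarith
    with d show "\<exists>i\<in>{d \<in> D. 1/2 < norm d}. norm (v - id i) \<le> 1/2"
      by force
  qed auto
qed

section \<open>Bump functions and their vector multiples\<close>

text \<open>Compact support puts the multiples by a vector into \<open>C0\<close>; attaining the
  value 1 gives them exactly the norm of that vector.\<close>

definition bump_on :: "'k::topological_space set \<Rightarrow> ('k \<Rightarrow> real) \<Rightarrow> bool" where
  "bump_on V \<phi> \<longleftrightarrow> continuous_on UNIV \<phi> \<and> (\<forall>t. 0 \<le> \<phi> t \<and> \<phi> t \<le> 1) \<and> (\<exists>t. \<phi> t = 1) \<and>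
    (\<forall>t. t \<notin> V \<longrightarrow> \<phi> t = 0) \<and> (\<exists>C. compact C \<and> (\<forall>t. t \<notin> C \<longrightarrow> \<phi> t = 0))"

lemma bump_onD:
  assumes "bump_on V \<phi>"
  shows "0 \<le> \<phi> t" "\<phi> t \<le> 1" "t \<notin> V \<Longrightarrow> \<phi> t = 0"
  using assms unfolding bump_on_def by blast+

text \<open>Locally compact Hausdorff spaces are completely regular. Separating a point of
  \<open>V\<close> from the complement of \<open>V \<inter> U\<close>, with \<open>U\<close> inside
  a compact set, yields both support conditions at once.\<close>

lemma bump_on_exists:
  assumes K: "locally_compact_space (euclidean :: 'k::t2_space topology)"
    and V: "open V" "V \<noteq> {}"
  shows "\<exists>\<phi> :: 'k \<Rightarrow> real. bump_on V \<phi>"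
proof -
  obtain t0 where t0: "t0 \<in> V"
    using V(2) by blast
  have "\<exists>U C. open U \<and> compact C \<and> t0 \<in> U \<and> U \<subseteq> C"
    using K unfolding locally_compact_space_def by simp
  then obtain U C where UC: "open U" "compact C" "t0 \<in> U" "U \<subseteq> C"
    by blast
  have "Hausdorff_space (euclidean :: 'k topology)"
    unfolding Hausdorff_space_def disjnt_def by simp (metis hausdorff)
  then have "completely_regular_space (euclidean :: 'k topology)"
    using K by (intro locally_compact_regular_imp_completely_regular_space
        locally_compact_Hausdorff_imp_regular_space) simp_all
  moreover have "closedin euclidean (- (V \<inter> U))"
    using V(1) UC(1) by (simp add: open_Int closed_open)
  moreover have "t0 \<in> topspace euclidean - (- (V \<inter> U))"
    using t0 UC by simp
  ultimately obtain f :: "'k \<Rightarrow> real" where f: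
    "continuous_map euclidean (top_of_set {0..1}) f" "f t0 = 0" "f ` (- (V \<inter> U)) \<subseteq> {1}"
    unfolding completely_regular_space_def by metis
  have cont: "continuous_on UNIV f" and rng: "0 \<le> f t" "f t \<le> 1" for t
    using f(1) by (auto simp: continuous_map_in_subtopology)
  have "f t = 1" if "t \<notin> V \<or> t \<notin> C" for t
    using f(3) UC(4) that by auto
  moreover have "continuous_on UNIV (\<lambda>t. 1 - f t)"
    using cont by (intro continuous_intros)
  ultimately have "bump_on V (\<lambda>t. 1 - f t)"
    unfolding bump_on_def using rng f(2) UC(2) by auto
  then show ?thesis by blast
qed

lemma scaled_bump_in_C0:
  fixes x :: "'x::real_normed_vector"
  assumes \<phi>: "bump_on V \<phi>"
  obtains g where "g \<in> C0" "\<And>t. apply_bcontfun g t = \<phi> t *\<^sub>R x" "norm g = norm x"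
proof -
  from \<phi> obtain C t0 where C: "compact C" "\<And>t. t \<notin> C \<Longrightarrow> \<phi> t = 0" and t0: "\<phi> t0 = 1"
    and cont: "continuous_on UNIV \<phi>"
    unfolding bump_on_def by blast
  have van: "\<forall>e>0. \<exists>C. compact C \<and> (\<forall>t. t \<notin> C \<longrightarrow> norm (\<phi> t *\<^sub>R x) < e)"
    using C by (metis norm_zero scaleR_zero_left)
  have "(\<lambda>t. \<phi> t *\<^sub>R x) \<in> bcontfun"
    using cont van by (intro vanishing_bcontfun continuous_intros)
  then have eq: "apply_bcontfun (Bcontfun (\<lambda>t. \<phi> t *\<^sub>R x)) t = \<phi> t *\<^sub>R x" for t
    by (simp add: Bcontfun_inverse)
  show ?thesis
  proof (rule that[OF _ eq])
    show "Bcontfun (\<lambda>t. \<phi> t *\<^sub>R x) \<in> C0"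
      using van by (simp add: C0_def eq)
    show "norm (Bcontfun (\<lambda>t. \<phi> t *\<^sub>R x)) = norm x"
    proof (rule antisym)
      show "norm (Bcontfun (\<lambda>t. \<phi> t *\<^sub>R x)) \<le> norm x"
        using bump_onD[OF \<phi>] by (intro norm_bound) (simp add: eq mult_left_le_one_le)
      show "norm x \<le> norm (Bcontfun (\<lambda>t. \<phi> t *\<^sub>R x))"
        using norm_bounded[of "Bcontfun (\<lambda>t. \<phi> t *\<^sub>R x)" t0] by (simp add: eq t0)
    qed
  qed
qed

text \<open>Outside a compact set the values stay below 1/2, so the supremum 1 is a maximum over
  that compact set.\<close>

lemma C0_attains_norm:
  assumes f: "f \<in> C0" "norm f = 1"
  obtains t0 where "norm (apply_bcontfun f t0) = 1"
proof -
  have "\<exists>C. compact C \<and> (\<forall>t. t \<notin> C \<longrightarrow> norm (apply_bcontfun f t) < 1/2)"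
    using f(1) half_gt_zero[OF zero_less_one] unfolding C0_def by blast
  then obtain C where C: "compact C" "\<And>t. t \<notin> C \<Longrightarrow> norm (apply_bcontfun f t) < 1/2"
    by blast
  have ne: "C \<noteq> {}"
  proof
    assume "C = {}"
    then have "norm (apply_bcontfun f t) \<le> 1/2" for t
      using C(2)[of t] by simp
    then have "norm f \<le> 1/2" by (rule norm_bound)
    with f(2) show False by simp
  qed
  have "continuous_on C (\<lambda>t. norm (apply_bcontfun f t))"
    by (intro continuous_intros) simp
  from continuous_attains_sup[OF C(1) ne this]
  obtain t0 where t0: "\<And>t. t \<in> C \<Longrightarrow> norm (apply_bcontfun f t) \<le> norm (apply_bcontfun f t0)"
    by blast
  have "norm (apply_bcontfun f t) \<le> max (norm (apply_bcontfun f t0)) (1/2)" for t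
    using t0[of t] C(2)[of t] by (cases "t \<in> C") auto
  then have "norm f \<le> max (norm (apply_bcontfun f t0)) (1/2)"
    by (rule norm_bound)
  then show ?thesis
    using that[of t0] f(2) norm_bounded[of f t0] by auto
qed

lemma exceeds_if_less_norm:
  fixes f :: "'k::topological_space \<Rightarrow>\<^sub>C 'x::real_normed_vector"
  assumes "r < norm f"
  shows "\<exists>t. r < norm (apply_bcontfun f t)"
proof (rule ccontr)
  assume "\<not> ?thesis"
  then have "norm f \<le> r" by (intro norm_bound) (auto simp: not_less)
  with assms show False by simp
qed

section \<open>From the BCP of the function space to \<open>K\<close> and \<open>X\<close>\<close>

text \<open>Nontriviality provides the unit vector that the bumps multiply; over the zero space the
  sphere of \<open>C0\<close> is empty and its BCP says nothing about the topology.\<close>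

lemma BCP_C0_imp_countable_pi_basis:
  assumes K: "locally_compact_space (euclidean :: 'k::t2_space topology)"
    and nontrivial: "\<exists>x :: 'x::real_normed_vector. x \<noteq> 0"
    and bcp: "BCP (C0 :: ('k \<Rightarrow>\<^sub>C 'x) set)"
  shows "\<exists>\<U> :: 'k set set. countable \<U> \<and> pi_basis \<U>"
proof -
  obtain x :: 'x where x: "norm x = 1"
    using nontrivial by (metis norm_sgn)
  obtain B where B: "countable B"
    "\<And>f r. (f, r) \<in> B \<Longrightarrow> f \<in> (C0 :: ('k \<Rightarrow>\<^sub>C 'x) set) \<and> 0 < r \<and> r < norm f"
    "\<And>g. g \<in> C0 \<Longrightarrow> norm g = 1 \<Longrightarrow> \<exists>(f, r)\<in>B. norm (g - f) \<le> r"
    using BCP_E[OF bcp] by blast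
  define U where "U = (\<lambda>(f :: 'k \<Rightarrow>\<^sub>C 'x, r). {t. r < norm (apply_bcontfun f t)})"
  have "open (U (f, r))" for f r
    unfolding U_def prod.case by (intro open_Collect_less continuous_intros) simp
  moreover have "U (f, r) \<noteq> {}" if "(f, r) \<in> B" for f r
    using exceeds_if_less_norm B(2)[OF that] unfolding U_def by auto
  moreover have "\<exists>p\<in>B. U p \<subseteq> V" if V: "open V" "V \<noteq> {}" for V
  proof -
    obtain \<phi> where \<phi>: "bump_on V \<phi>"
      using bump_on_exists[OF K V] by blast
    obtain g where g: "g \<in> C0" "\<And>t. apply_bcontfun g t = \<phi> t *\<^sub>R x" "norm g = norm x"
      using scaled_bump_in_C0[OF \<phi>] by blast
    then obtain f r where fr: "(f, r) \<in> B" "norm (g - f) \<le> r"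
      using B(3)[OF g(1)] x by auto
    have "t \<in> V" if "r < norm (apply_bcontfun f t)" for t
    proof (rule ccontr)
      assume "t \<notin> V"
      then have "norm (apply_bcontfun f t) = norm (apply_bcontfun (g - f) t)"
        using bump_onD(3)[OF \<phi>] g(2) by simp
      also have "\<dots> \<le> r"
        using norm_bounded[of "g - f" t] fr(2) by linarith
      finally show False using that by simp
    qed
    with fr(1) show ?thesis by (auto simp: U_def intro!: bexI[of _ "(f, r)"])
  qed
  ultimately have "pi_basis (U ` B)"
    unfolding pi_basis_def by fastforce
  with B(1) show ?thesis by blast
qed

text \<open>Evaluation at \<open>t\<close> does not increase norms, so it sends a ball about
  \<open>f\<close> into the ball of the same radius about \<open>f t\<close>, which misses the
  origin if \<open>t\<close> is chosen where \<open>f\<close> exceeds the radius. Using one fixed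
  bump makes these points independent of the vector to be covered.\<close>

lemma BCP_C0_imp_BCP_range:
  assumes K: "locally_compact_space (euclidean :: 'k::t2_space topology)"
    and bcp: "BCP (C0 :: ('k \<Rightarrow>\<^sub>C 'x::real_normed_vector) set)"
  shows "BCP (UNIV :: 'x set)"
proof -
  obtain B where B: "countable B"
    "\<And>f r. (f, r) \<in> B \<Longrightarrow> f \<in> (C0 :: ('k \<Rightarrow>\<^sub>C 'x) set) \<and> 0 < r \<and> r < norm f"
    "\<And>g. g \<in> C0 \<Longrightarrow> norm g = 1 \<Longrightarrow> \<exists>(f, r)\<in>B. norm (g - f) \<le> r"
    using BCP_E[OF bcp] by blast
  obtain \<phi> where \<phi>: "bump_on (UNIV :: 'k set) \<phi>"
    using bump_on_exists[OF K open_UNIV UNIV_not_empty] by blast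
  have "\<exists>t. snd p < norm (apply_bcontfun (fst p) t)" if "p \<in> B" for p
    using B(2)[of "fst p" "snd p"] that by (simp add: exceeds_if_less_norm)
  then obtain \<tau> where "\<And>p. p \<in> B \<Longrightarrow> snd p < norm (apply_bcontfun (fst p) (\<tau> p))"
    by metis
  then have \<tau>: "r < norm (apply_bcontfun f (\<tau> (f, r)))" if "(f, r) \<in> B" for f r
    using that by fastforce
  define I where "I = {p \<in> B. 0 < \<phi> (\<tau> p)}"
  define c where "c p = apply_bcontfun (fst p) (\<tau> p) /\<^sub>R \<phi> (\<tau> p)" for p
  define s where "s p = snd p / \<phi> (\<tau> p)" for p
  show ?thesis
  proof (rule BCP_I[where I = I and c = c and r = s])
    show "countable I"
      unfolding I_def using B(1) by (rule countable_subset[rotated]) auto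
    show "c p \<in> UNIV \<and> 0 < s p \<and> s p < norm (c p)" if "p \<in> I" for p
      using that B(2) \<tau> by (cases p) (auto simp: I_def c_def s_def field_simps)
  next
    fix v :: 'x assume v: "norm v = 1"
    obtain g where g: "g \<in> C0" "\<And>t. apply_bcontfun g t = \<phi> t *\<^sub>R v" "norm g = norm v"
      using scaled_bump_in_C0[OF \<phi>] by blast
    then obtain f r where fr: "(f, r) \<in> B" "norm (g - f) \<le> r"
      using B(3)[OF g(1)] v by auto
    define t where "t = \<tau> (f, r)"
    have le: "norm (\<phi> t *\<^sub>R v - apply_bcontfun f t) \<le> r"
      using norm_bounded[of "g - f" t] fr(2) g(2) by simp
    \<comment> \<open>If \<open>\<phi> t\<close> were 0, \<open>le\<close> would bound the value of
      \<open>f\<close> at \<open>t\<close> by \<open>r\<close>, against the choice of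
      \<open>\<tau>\<close>. So restricting to \<open>I\<close> loses no ball that is used.\<close>
    have "\<phi> t \<noteq> 0"
      using le \<tau>[OF fr(1)] by (auto simp: t_def)
    with bump_onD(1)[OF \<phi>, of t] have pos: "0 < \<phi> t" by simp
    have "v - apply_bcontfun f t /\<^sub>R \<phi> t = (\<phi> t *\<^sub>R v - apply_bcontfun f t) /\<^sub>R \<phi> t"
      using pos by (simp add: scaleR_diff_right)
    then have "norm (v - apply_bcontfun f t /\<^sub>R \<phi> t) \<le> r / \<phi> t"
      using le pos by (simp add: divide_simps mult.commute)
    then show "\<exists>p\<in>I. norm (v - c p) \<le> s p"
      using fr(1) pos by (intro bexI[of _ "(f, r)"]) (auto simp: I_def c_def s_def t_def)
  qed
qed

section \<open>From \<open>K\<close> and \<open>X\<close> back to the function space\<close>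

lemma BCP_C0_if_countable_pi_basis:
  assumes K: "locally_compact_space (euclidean :: 'k::t2_space topology)"
    and \<U>: "countable \<U>" "pi_basis (\<U> :: 'k set set)"
    and bcp: "BCP (UNIV :: 'x::real_normed_vector set)"
  shows "BCP (C0 :: ('k \<Rightarrow>\<^sub>C 'x) set)"
proof -
  obtain B where B: "countable B" "\<And>x r. (x, r) \<in> B \<Longrightarrow> 0 < r \<and> r < norm (x :: 'x)"
    "\<And>v. norm v = 1 \<Longrightarrow> \<exists>(x, r)\<in>B. norm (v - x) \<le> r"
    using BCP_E[OF bcp] by (metis UNIV_I)
  have "\<exists>\<phi> :: 'k \<Rightarrow> real. bump_on U \<phi>" if "U \<in> \<U>" for U
    using bump_on_exists[OF K] \<U>(2) that unfolding pi_basis_def by blast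
  then obtain \<phi> where \<phi>: "\<And>U :: 'k set. U \<in> \<U> \<Longrightarrow> bump_on U (\<phi> U)"
    by metis
  have "\<exists>g\<in>C0. (\<forall>t. apply_bcontfun g t = \<phi> U t *\<^sub>R y) \<and> norm g = norm y"
    if "U \<in> \<U>" for U and y :: 'x
    using scaled_bump_in_C0[OF \<phi>[OF that]] by metis
  then obtain G where G: "\<And>U y. U \<in> \<U> \<Longrightarrow> G U y \<in> C0"
    "\<And>U y t. U \<in> \<U> \<Longrightarrow> apply_bcontfun (G U y) t = \<phi> U t *\<^sub>R (y :: 'x)"
    "\<And>U y. U \<in> \<U> \<Longrightarrow> norm (G U y) = norm y"
    by metis
  text \<open>The dilation factor, at least 1 and so large that the dilated ball has radius at least 1.\<close>
  define L where "L = (\<lambda>(x :: 'x, r :: real). 1 + (1 + norm x - r) / norm x)"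
  \<comment> \<open>The dilated ball has radius \<open>r + (L (x, r) - 1) * norm x\<close>, at the
    same distance \<open>norm x - r\<close> from the origin. \<open>R\<close> adds half of that
    distance, as room for the oscillation of \<open>f\<close> near \<open>t0\<close>.\<close>
  define R where "R = (\<lambda>(x :: 'x, r :: real). L (x, r) * norm x - (norm x - r) / 2)"
  define c where "c = (\<lambda>(U, p). G U (L p *\<^sub>R fst p))"
  show ?thesis
  proof (rule BCP_I[where I = "\<U> \<times> B" and c = c and r = "R \<circ> snd"])
    show "countable (\<U> \<times> B)"
      using \<U>(1) B(1) by simp
  next
    fix i assume "i \<in> \<U> \<times> B"
    then obtain U x r where i: "i = (U, x, r)" "U \<in> \<U>" "(x, r) \<in> B" by auto
    have r: "0 < r" "r < norm x" using B(2)[OF i(3)] by auto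
    then have "0 < norm x" by linarith
    then have L: "L (x, r) * norm x = norm x + (1 + norm x - r)" "0 \<le> L (x, r)"
      using r by (auto simp: L_def field_simps)
    show "c i \<in> C0 \<and> 0 < (R \<circ> snd) i \<and> (R \<circ> snd) i < norm (c i)"
      using r L G(1)[OF i(2)] G(3)[OF i(2)] by (simp add: i(1) c_def R_def)
  next
    fix f :: "'k \<Rightarrow>\<^sub>C 'x" assume f: "f \<in> C0" "norm f = 1"
    obtain t0 where t0: "norm (apply_bcontfun f t0) = 1"
      using C0_attains_norm[OF f] .
    define v where "v = apply_bcontfun f t0"
    obtain x r where xr: "(x, r) \<in> B" "norm (v - x) \<le> r"
      using B(3)[of v] t0 v_def by blast
    have r: "0 < r" "r < norm x" using B(2)[OF xr(1)] by auto
    then have "0 < norm x" by linarith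
    then have L: "L (x, r) * norm x = norm x + (1 + norm x - r)" "1 \<le> L (x, r)"
      using r by (auto simp: L_def field_simps)
    \<comment> \<open>On \<open>V\<close> the function differs from its value at \<open>t0\<close>
      by less than the margin built into \<open>R\<close>.\<close>
    define V where "V = {t. norm (apply_bcontfun f t - v) < (norm x - r) / 2}"
    have "open V"
      unfolding V_def by (intro open_Collect_less continuous_intros) simp
    moreover have "t0 \<in> V"
      using r by (simp add: V_def v_def)
    ultimately obtain U where U: "U \<in> \<U>" "U \<subseteq> V"
      using \<U>(2) unfolding pi_basis_def by blast
    define y where "y = L (x, r) *\<^sub>R x"
    have "norm (x - y) = (L (x, r) - 1) * norm x"
    proof -
      have "y - x = (L (x, r) - 1) *\<^sub>R x"
        by (simp add: y_def scaleR_diff_left)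
      then show ?thesis
        using L(2) by (simp add: norm_minus_commute[of x y])
    qed
    then have vy: "norm (v - y) \<le> r + (L (x, r) - 1) * norm x"
      using norm_triangle_ineq[of "v - x" "x - y"] xr(2) by simp
    \<comment> \<open>Off \<open>U\<close> the centre \<open>G U y\<close> vanishes, so there the
      radius has to dominate \<open>f\<close> itself.\<close>
    have R1: "1 \<le> R (x, r)"
      using L(1) r by (simp add: R_def field_simps)
    have "norm (apply_bcontfun (f - G U y) t) \<le> R (x, r)" for t
    proof -
      have ft: "norm (apply_bcontfun f t) \<le> R (x, r)"
        using norm_bounded[of f t] f(2) R1 by linarith
      show ?thesis
      proof (cases "t \<in> U")
        case False
        then show ?thesis using ft G(2)[OF U(1)] bump_onD(3)[OF \<phi>[OF U(1)]] by simp
      next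
        case True
        then have "norm (apply_bcontfun f t - v) < (norm x - r) / 2"
          using U(2) by (auto simp: V_def)
        then have fy: "norm (apply_bcontfun f t - y) \<le> R (x, r)"
          using norm_triangle_ineq[of "apply_bcontfun f t - v" "v - y"] vy
          by (simp add: R_def left_diff_distrib diff_divide_distrib)
        \<comment> \<open>A convex combination of two vectors of norm at most
          \<open>R (x, r)\<close>, which handles intermediate values of the bump.\<close>
        have "apply_bcontfun (f - G U y) t =
            (1 - \<phi> U t) *\<^sub>R apply_bcontfun f t + \<phi> U t *\<^sub>R (apply_bcontfun f t - y)"
          using G(2) U(1) by (simp add: algebra_simps)
        also have "norm \<dots> \<le> (1 - \<phi> U t) * norm (apply_bcontfun f t)
            + \<phi> U t * norm (apply_bcontfun f t - y)"
          using bump_onD(1,2)[OF \<phi>[OF U(1)], of t] by (intro norm_triangle_le) simp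
        also have "\<dots> \<le> R (x, r)"
          using bump_onD(1,2)[OF \<phi>[OF U(1)], of t] ft fy by (intro convex_bound_le) auto
        finally show ?thesis .
      qed
    qed
    then have "norm (f - G U y) \<le> R (x, r)"
      by (rule norm_bound)
    then show "\<exists>i\<in>\<U> \<times> B. norm (f - c i) \<le> (R \<circ> snd) i"
      using U(1) xr(1) by (intro bexI[of _ "(U, x, r)"]) (auto simp: c_def y_def)
  qed
qed

text \<open>Values in any nonzero real normed space are allowed, so that both \<open>'x\<close> and
  the scalar field \<open>'f\<close> are instances.\<close>

lemma BCP_C0_iff:
  assumes "locally_compact_space (euclidean :: 'k::t2_space topology)"
    and "\<exists>x :: 'x::real_normed_vector. x \<noteq> 0"
  shows "BCP (C0 :: ('k \<Rightarrow>\<^sub>C 'x) set) \<longleftrightarrow>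
    (\<exists>\<U> :: 'k set set. countable \<U> \<and> pi_basis \<U>) \<and> BCP (UNIV :: 'x set)"
  using BCP_C0_imp_countable_pi_basis[OF assms] BCP_C0_imp_BCP_range[OF assms(1)]
    BCP_C0_if_countable_pi_basis[OF assms(1)]
  by (intro iffI conjI) (assumption | blast)+

theorem theorem2p2:
  fixes scale :: "'f::{real_normed_field, euclidean_space} \<Rightarrow> 'x::banach \<Rightarrow> 'x"
  assumes K: "locally_compact_space (euclidean :: 'k::t2_space topology)"
    and X: "banach_space_over scale"
    and X_nontrivial: "\<exists>x :: 'x. x \<noteq> 0"
  shows "(BCP (C0 :: ('k \<Rightarrow>\<^sub>C 'x) set) \<longleftrightarrow>
            BCP (C0 :: ('k \<Rightarrow>\<^sub>C 'f) set) \<and> BCP (UNIV :: 'x set)) \<and>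
         (BCP (C0 :: ('k \<Rightarrow>\<^sub>C 'f) set) \<and> BCP (UNIV :: 'x set) \<longleftrightarrow>
            (\<exists>\<U> :: 'k set set. countable \<U> \<and> pi_basis \<U>) \<and> BCP (UNIV :: 'x set))"
proof -
  have "\<exists>a :: 'f. a \<noteq> 0"
    using one_neq_zero by blast
  \<comment> \<open>The scalar field has the BCP, so for scalar functions only the condition on
    \<open>K\<close> remains.\<close>
  then have "BCP (C0 :: ('k \<Rightarrow>\<^sub>C 'f) set) \<longleftrightarrow> (\<exists>\<U> :: 'k set set. countable \<U> \<and> pi_basis \<U>)"
    using BCP_C0_iff[OF K, where ?'x = 'f] BCP_euclidean_space by blast
  then show ?thesis
    using BCP_C0_iff[OF K X_nontrivial] by blast
qed

end
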